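(* Let $a,b$ be integers with $2\le a\le b$. Then $\Delta(P(a,b))$ is contractible if and only if $a=b=3$. Moreover, $\Delta(P(3,3))$ is collapsible.
   Context: Here $\mathbb{N}=\{0,1,2,\ldots\}$. For $(a_1,a_2),(b_1,b_2)\in\mathbb{N}^2$, say that $(a_1,a_2)$ properly divides $(b_1,b_2)$ if for each $i$ either $a_i=b_i=0$ or $a_i<b_i$. Write $(a_1,a_2)\le(b_1,b_2)$ if the two are equal or the first properly divides the second; this is a partial order. $P(a,b)$ is the set of all $(c,d)\in\mathbb{N}^2$ with $(c,d)\le(a,b)$, ordered by $\le$; it has unique minimal element $\widehat 0=(0,0)$ and unique maximal element $\widehat 1=(a,b)$. The order complex $\Delta(P(a,b))$ is the simplicial complex of all chains in $P(a,b)\setminus\{\widehat 0,\widehat 1\}$. Contractibility refers to its geometric realization; collapsible means that it can be reduced to a point by a sequence of elementary simplicial collapses. *)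

theory Defs
  imports "HOL-Analysis.Analysis"
begin

definition properly_divides :: "nat \<times> nat \<Rightarrow> nat \<times> nat \<Rightarrow> bool" where
  "properly_divides x y \<longleftrightarrow>
     (fst x = 0 \<and> fst y = 0 \<or> fst x < fst y) \<and>
     (snd x = 0 \<and> snd y = 0 \<or> snd x < snd y)"

definition pd_le :: "nat \<times> nat \<Rightarrow> nat \<times> nat \<Rightarrow> bool" where
  "pd_le x y \<longleftrightarrow> x = y \<or> properly_divides x y"

definition P :: "nat \<Rightarrow> nat \<Rightarrow> (nat \<times> nat) set" where
  "P a b = {x. pd_le x (a, b)}"

text \<open>An abstract simplicial complex is represented by the set of its nonempty simplices; the
  empty face is left out, so that no collapse can remove a vertex together with the empty face.\<close>

definition order_complex :: "('a \<Rightarrow> 'a \<Rightarrow> bool) \<Rightarrow> 'a set \<Rightarrow> 'a set set" where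
  "order_complex le S = {C. C \<subseteq> S \<and> finite C \<and> C \<noteq> {} \<and> Complete_Partial_Order.chain le C}"

definition Delta_P :: "nat \<Rightarrow> nat \<Rightarrow> (nat \<times> nat) set set" where
  "Delta_P a b = order_complex pd_le (P a b - {(0, 0), (a, b)})"

text \<open>Points of the realization are given by their barycentric coordinates. The topology is the
  one of pointwise convergence, which for finite complexes (such as \<^const>\<open>Delta_P\<close>)
  coincides with the weak topology.\<close>

definition geometric_realization :: "'a set set \<Rightarrow> ('a \<Rightarrow> real) topology" where
  "geometric_realization K =
     subtopology (powertop_real UNIV)
       {x. (\<forall>v. 0 \<le> x v) \<and> {v. x v \<noteq> 0} \<in> K \<and> (\<Sum>v | x v \<noteq> 0. x v) = 1}"

text \<open>A free face \<open>\<tau>\<close> is removed together with the only simplex \<open>\<sigma>\<close> that properly contains it.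
  In a simplicial complex this uniqueness forces \<open>\<sigma>\<close> to be maximal, of dimension one more
  than that of \<open>\<tau>\<close>.\<close>

definition elementary_collapse :: "'a set set \<Rightarrow> 'a set set \<Rightarrow> bool" where
  "elementary_collapse K L \<longleftrightarrow>
     (\<exists>\<sigma> \<tau>. \<tau> \<in> K \<and> {\<rho> \<in> K. \<tau> \<subset> \<rho>} = {\<sigma>} \<and> L = K - {\<sigma>, \<tau>})"

definition collapsible :: "'a set set \<Rightarrow> bool" where
  "collapsible K \<longleftrightarrow> (\<exists>v. elementary_collapse\<^sup>*\<^sup>* K {{v}})"

lemma pd_le_order: "class.order pd_le (\<lambda>x y. pd_le x y \<and> x \<noteq> y)"
  by unfold_locales (auto simp: pd_le_def properly_divides_def prod_eq_iff)

lemma P_bounds: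
  assumes "x \<in> P a b"
  shows "pd_le (0, 0) x" and "pd_le x (a, b)"
  using assms by (auto simp: P_def pd_le_def properly_divides_def)

end

theory Submission
  imports Defs "HOL-Homology.Brouwer_Degree"
begin

text \<open>
  Suppose first that \<open>2 \<le> a \<le> b\<close> and \<open>(a, b)\<close> is not \<open>(3, 3)\<close>. Then the complex
  retracts simplicially onto the boundary of a cross-polytope: its vertices can be labelled by the vertices of the cross-polytope
  so that comparable elements never get opposite labels, and there are elements of each label that
  form a copy of the cross-polytope. The boundary of the \<open>(n+1)\<close>-dimensional cross-polytope is an
  \<open>n\<close>-sphere, so the identity of a sphere factors through the complex, which therefore is not
  contractible.

  For \<open>a = 2\<close> the sphere has dimension 0, because \<open>(1, 0)\<close> is comparable to no other element.
  For \<open>a \<ge> 3\<close> and \<open>b \<ge> 4\<close> it has dimension 1. The edge from \<open>(1, 1)\<close> to \<open>(2, b - 1)\<close> is a maximal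
  chain: nothing lies below its first element, above its second one, or between the two. So no
  other element is comparable to both ends, and the complex maps to a square whose corners
  receive, in cyclic order, \<open>(1, 1)\<close>, \<open>(2, b - 1)\<close>, the other neighbours of \<open>(2, b - 1)\<close>, and
  everything else. The elements \<open>(1, 0)\<close> and \<open>(2, b - 2)\<close> complete the edge to a 4-cycle on
  which this labelling is bijective.

  The complex for \<open>(3, 3)\<close> is a tree with 8 vertices. Removing its leaves one by one collapses it
  to a vertex. For contractibility two homotopies suffice, both between contiguous
  simplicial maps: folding the leaves onto the path from \<open>(1, 0)\<close> over \<open>(2, 2)\<close> to \<open>(0, 1)\<close>, and
  shrinking that path to its middle vertex.
\<close>

section \<open>Simplicial maps between geometric realizations\<close>

lemma topspace_geometric_realization:
  "topspace (geometric_realization K) =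
     {x. (\<forall>v. 0 \<le> x v) \<and> {v. x v \<noteq> 0} \<in> K \<and> (\<Sum>v | x v \<noteq> 0. x v) = 1}"
  by (simp add: geometric_realization_def)

lemma continuous_map_barycentric_coordinate:
  "continuous_map (geometric_realization K) euclideanreal (\<lambda>x. x v)"
  unfolding geometric_realization_def
  by (intro continuous_map_from_subtopology continuous_map_product_projection) simp

lemma continuous_map_into_geometric_realization:
  assumes "\<And>v. continuous_map X euclideanreal (\<lambda>x. f x v)"
    and "f \<in> topspace X \<rightarrow> topspace (geometric_realization K)"
  shows "continuous_map X (geometric_realization K) f"
  using assms
  by (auto simp: geometric_realization_def continuous_map_in_subtopology
      continuous_map_componentwise_UNIV)

text \<open>The affine extension of the vertex map \<open>f\<close> to barycentric coordinates. Summing over a fixed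
  vertex set \<open>V\<close> instead of the support of \<open>x\<close> makes each coordinate a finite sum of
  projections, hence continuous.\<close>

definition pushforward :: "'a set \<Rightarrow> ('a \<Rightarrow> 'b) \<Rightarrow> ('a \<Rightarrow> real) \<Rightarrow> 'b \<Rightarrow> real" where
  "pushforward V f x v = (\<Sum>u\<in>{u \<in> V. f u = v}. x u)"

lemma pushforward_nonneg: "(\<And>u. 0 \<le> x u) \<Longrightarrow> 0 \<le> pushforward V f x v"
  by (simp add: pushforward_def sum_nonneg)

lemma support_pushforward:
  assumes "finite V" and "\<And>u. 0 \<le> x u" and "{u. x u \<noteq> 0} \<subseteq> V"
  shows "{v. pushforward V f x v \<noteq> 0} = f ` {u. x u \<noteq> 0}"
proof -
  have "pushforward V f x v = 0 \<longleftrightarrow> (\<forall>u\<in>{u \<in> V. f u = v}. x u = 0)" for v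
    unfolding pushforward_def using assms by (intro sum_nonneg_eq_0_iff) auto
  then show ?thesis
    using assms(3) by auto
qed

lemma sum_pushforward:
  assumes "finite V" and "finite W" and "f ` V \<subseteq> W"
  shows "sum (pushforward V f x) W = sum x V"
  using sum.group[OF assms, of x] by (simp add: pushforward_def)

lemma sum_support_eq:
  fixes x :: "'a \<Rightarrow> real"
  assumes "finite V" and "{u. x u \<noteq> 0} \<subseteq> V"
  shows "(\<Sum>u | x u \<noteq> 0. x u) = sum x V"
  using assms by (intro sum.mono_neutral_left) auto

lemma sum_support_pushforward:
  assumes "finite V" and "\<And>u. 0 \<le> x u" and "{u. x u \<noteq> 0} \<subseteq> V"
  shows "(\<Sum>v | pushforward V f x v \<noteq> 0. pushforward V f x v) = (\<Sum>u | x u \<noteq> 0. x u)"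
proof -
  have "(\<Sum>v | pushforward V f x v \<noteq> 0. pushforward V f x v) = sum (pushforward V f x) (f ` V)"
    using assms support_pushforward[OF assms, of f] by (intro sum_support_eq) auto
  also have "\<dots> = sum x V"
    using assms by (intro sum_pushforward) auto
  finally show ?thesis
    using assms by (simp add: sum_support_eq)
qed

lemma continuous_map_pushforward_coordinate:
  assumes "finite V"
  shows "continuous_map (geometric_realization K) euclideanreal (\<lambda>x. pushforward V f x v)"
  unfolding pushforward_def using assms
  by (intro continuous_map_sum continuous_map_barycentric_coordinate) auto

lemma pushforward_in_realization:
  assumes V: "finite V" "\<Union>K \<subseteq> V" and f: "\<And>\<sigma>. \<sigma> \<in> K \<Longrightarrow> f ` \<sigma> \<in> L"
    and x: "x \<in> topspace (geometric_realization K)"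
  shows "pushforward V f x \<in> topspace (geometric_realization L)"
proof -
  have x': "\<And>u. 0 \<le> x u" "{u. x u \<noteq> 0} \<in> K" "(\<Sum>u | x u \<noteq> 0. x u) = 1"
    using x by (auto simp: topspace_geometric_realization)
  then have sub: "{u. x u \<noteq> 0} \<subseteq> V"
    using V by blast
  have "{v. pushforward V f x v \<noteq> 0} \<in> L"
    using f[OF x'(2)] by (simp only: support_pushforward[OF V(1) x'(1) sub])
  moreover have "(\<Sum>v | pushforward V f x v \<noteq> 0. pushforward V f x v) = 1"
    by (simp only: sum_support_pushforward[OF V(1) x'(1) sub] x'(3))
  ultimately show ?thesis
    using x'(1) by (simp add: topspace_geometric_realization pushforward_nonneg)
qed

lemma continuous_map_pushforward:
  assumes "finite V" "\<Union>K \<subseteq> V" and "\<And>\<sigma>. \<sigma> \<in> K \<Longrightarrow> f ` \<sigma> \<in> L"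
  shows "continuous_map (geometric_realization K) (geometric_realization L) (pushforward V f)"
  using assms
  by (intro continuous_map_into_geometric_realization continuous_map_pushforward_coordinate
      funcsetI pushforward_in_realization)

lemma pushforward_id:
  assumes "{u. x u \<noteq> 0} \<subseteq> V"
  shows "pushforward V (\<lambda>u. u) x = x"
proof
  fix v
  have "{u \<in> V. u = v} = (if v \<in> V then {v} else {})"
    by auto
  then show "pushforward V (\<lambda>u. u) x v = x v"
    using assms by (auto simp: pushforward_def)
qed

lemma pushforward_const: "pushforward V (\<lambda>_. c) x = (\<lambda>v. if v = c then sum x V else 0)"
  by (auto simp: pushforward_def fun_eq_iff)

lemma pushforward_pushforward:
  assumes "finite V" "finite W" "f ` V \<subseteq> W"
  shows "pushforward W g (pushforward V f x) = pushforward V (\<lambda>u. g (f u)) x"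
proof
  fix w
  have "pushforward W g (pushforward V f x) w =
      (\<Sum>v\<in>{v \<in> W. g v = w}. \<Sum>u\<in>{u \<in> {u \<in> V. g (f u) = w}. f u = v}. x u)"
    unfolding pushforward_def by (intro sum.cong refl) auto
  also have "\<dots> = (\<Sum>u\<in>{u \<in> V. g (f u) = w}. x u)"
    using assms by (intro sum.group) auto
  finally show "pushforward W g (pushforward V f x) w = pushforward V (\<lambda>u. g (f u)) x w"
    by (simp add: pushforward_def)
qed

lemma pushforward_cong:
  "(\<And>u. u \<in> V \<Longrightarrow> f u = g u) \<Longrightarrow> pushforward V f = pushforward V g"
  by (auto simp: pushforward_def fun_eq_iff intro!: sum.cong)

text \<open>Contiguous simplicial maps are homotopic along straight lines: for each simplex \<open>\<sigma>\<close> the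
  segments from the image of a point under \<open>f\<close> to its image under \<open>g\<close> stay in the simplex
  \<open>f ` \<sigma> \<union> g ` \<sigma>\<close>.\<close>

lemma homotopic_contiguous:
  assumes V: "finite V" "\<Union>K \<subseteq> V"
    and f: "\<And>\<sigma>. \<sigma> \<in> K \<Longrightarrow> f ` \<sigma> \<in> L" and g: "\<And>\<sigma>. \<sigma> \<in> K \<Longrightarrow> g ` \<sigma> \<in> L"
    and fg: "\<And>\<sigma>. \<sigma> \<in> K \<Longrightarrow> f ` \<sigma> \<union> g ` \<sigma> \<in> L"
  shows "homotopic_with (\<lambda>_. True) (geometric_realization K) (geometric_realization L)
           (pushforward V f) (pushforward V g)"
proof -
  define h where
    "h = (\<lambda>(t, x) v. (1 - t) * pushforward V f x v + t * pushforward V g x v)"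
  let ?X = "prod_topology (top_of_set {0..1::real}) (geometric_realization K)"
  have cont: "continuous_map ?X euclideanreal (\<lambda>p. h p v)" for v
  proof -
    have fst: "continuous_map ?X euclideanreal fst"
      using continuous_map_fst continuous_map_into_fulltopology by blast
    have push: "continuous_map ?X euclideanreal (\<lambda>p. pushforward V k (snd p) v)" for k :: "'a \<Rightarrow> 'b"
      using continuous_map_compose[OF continuous_map_snd continuous_map_pushforward_coordinate[OF V(1)]]
      by (simp add: o_def)
    show ?thesis
      unfolding h_def case_prod_unfold
      by (intro continuous_intros fst push)
  qed
  have into: "h (t, x) \<in> topspace (geometric_realization L)"
    if t: "t \<in> {0..1}" and x: "x \<in> topspace (geometric_realization K)" for t x
  proof -
    let ?\<sigma> = "{u. x u \<noteq> 0}"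
    let ?f = "pushforward V f x" and ?g = "pushforward V g x"
    have x': "\<And>u. 0 \<le> x u" "?\<sigma> \<in> K" "(\<Sum>u | x u \<noteq> 0. x u) = 1"
      using x by (auto simp: topspace_geometric_realization)
    then have sub: "?\<sigma> \<subseteq> V"
      using V by blast
    have f_pos: "0 \<le> ?f v" and g_pos: "0 \<le> ?g v" for v
      using x' by (simp_all add: pushforward_nonneg)
    consider "t = 0" | "t = 1" | "0 < t" "t < 1"
      using t by fastforce
    then show ?thesis
    proof cases
      case 1
      then have "h (t, x) = ?f"
        by (simp add: h_def)
      then show ?thesis
        using pushforward_in_realization[OF V f x] by simp
    next
      case 2
      then have "h (t, x) = ?g"
        by (simp add: h_def)
      then show ?thesis
        using pushforward_in_realization[OF V g x] by simp
    next
      case 3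
      \<comment> \<open>Both weights are positive, so the supports do not cancel and add up to the union.\<close>
      have pos: "0 \<le> h (t, x) v" for v
        using 3 f_pos[of v] g_pos[of v] by (simp add: h_def)
      have "h (t, x) v = 0 \<longleftrightarrow> ?f v = 0 \<and> ?g v = 0" for v
        using 3 f_pos[of v] g_pos[of v] by (auto simp: h_def add_nonneg_eq_0_iff)
      then have "{v. h (t, x) v \<noteq> 0} = {v. ?f v \<noteq> 0} \<union> {v. ?g v \<noteq> 0}"
        by auto
      also have "\<dots> = f ` ?\<sigma> \<union> g ` ?\<sigma>"
        using V x' sub by (simp add: support_pushforward)
      finally have supp: "{v. h (t, x) v \<noteq> 0} = f ` ?\<sigma> \<union> g ` ?\<sigma>" .
      let ?W = "f ` V \<union> g ` V"
      have "(\<Sum>v | h (t, x) v \<noteq> 0. h (t, x) v) = sum (h (t, x)) ?W"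
        using supp V sub by (intro sum_support_eq) auto
      also have "\<dots> = (1 - t) * sum ?f ?W + t * sum ?g ?W"
        by (simp add: h_def sum.distrib sum_distrib_left)
      also have "\<dots> = 1"
        using V x'(3) sum_support_eq[OF V(1) sub] by (simp add: sum_pushforward)
      finally show ?thesis
        using pos supp fg[OF x'(2)] by (simp add: topspace_geometric_realization)
    qed
  qed
  have "continuous_map ?X (geometric_realization L) h"
    using cont into by (intro continuous_map_into_geometric_realization) auto
  then show ?thesis
    unfolding homotopic_with_def
    by (intro exI[of _ h]) (auto simp: h_def fun_eq_iff)
qed

section \<open>Cross-polytopes and spheres\<close>

text \<open>The boundary of the cross-polytope with vertices \<open>\<plusminus>e\<^sub>0, \<dots>, \<plusminus>e\<^sub>n\<close>, where the sign is a
  Boolean: a face is a set of vertices without an opposite pair.\<close>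

definition cross_polytope :: "nat \<Rightarrow> (nat \<times> bool) set set" where
  "cross_polytope n =
     {\<sigma>. \<sigma> \<noteq> {} \<and> \<sigma> \<subseteq> {..n} \<times> UNIV \<and> (\<forall>i. \<not> ((i, True) \<in> \<sigma> \<and> (i, False) \<in> \<sigma>))}"

text \<open>These two maps restrict to inverse homeomorphisms between the sphere and the boundary of the
  cross-polytope. Squaring the coordinates of a unit vector gives weights with sum 1; the weight of
  each coordinate is put on one of two opposite vertices, according to its sign.\<close>

definition sphere_to_cross :: "(nat \<Rightarrow> real) \<Rightarrow> nat \<times> bool \<Rightarrow> real" where
  "sphere_to_cross u = (\<lambda>(i, s). (max 0 (if s then u i else - u i))\<^sup>2)"

definition cross_to_sphere :: "(nat \<times> bool \<Rightarrow> real) \<Rightarrow> nat \<Rightarrow> real" where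
  "cross_to_sphere x i = sqrt (x (i, True)) - sqrt (x (i, False))"

lemma cross_to_sphere_to_cross: "cross_to_sphere (sphere_to_cross u) = u"
  by (auto simp: cross_to_sphere_def sphere_to_cross_def fun_eq_iff max_def)

lemma sum_times_bool:
  fixes x :: "nat \<times> bool \<Rightarrow> real"
  shows "sum x ({..n} \<times> UNIV) = (\<Sum>i\<le>n. x (i, True) + x (i, False))"
proof -
  have "sum x ({..n} \<times> UNIV) = (\<Sum>i\<le>n. \<Sum>s\<in>UNIV. x (i, s))"
    by (simp add: sum.cartesian_product)
  then show ?thesis
    by (simp add: UNIV_bool add.commute)
qed

lemma continuous_map_sphere_to_cross:
  "continuous_map (nsphere n) (geometric_realization (cross_polytope n)) sphere_to_cross"
proof (rule continuous_map_into_geometric_realization)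
  have coord: "continuous_map (nsphere n) euclideanreal (\<lambda>u. u i)" for i
    unfolding nsphere
    by (intro continuous_map_from_subtopology continuous_map_product_projection) simp
  show "continuous_map (nsphere n) euclideanreal (\<lambda>u. sphere_to_cross u v)" for v
    by (cases v; cases "snd v")
      (auto simp: sphere_to_cross_def intro!: continuous_intros coord)
  show "sphere_to_cross \<in> topspace (nsphere n) \<rightarrow> topspace (geometric_realization (cross_polytope n))"
  proof
    fix u :: "nat \<Rightarrow> real"
    assume "u \<in> topspace (nsphere n)"
    then have u: "(\<Sum>i\<le>n. (u i)\<^sup>2) = 1" "\<And>i. i > n \<Longrightarrow> u i = 0"
      by (auto simp: nsphere)
    let ?x = "sphere_to_cross u"
    have sub: "{v. ?x v \<noteq> 0} \<subseteq> {..n} \<times> UNIV"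
    proof clarsimp
      fix i s
      assume "?x (i, s) \<noteq> 0"
      then show "i \<le> n"
        using u(2)[of i] by (cases "i \<le> n") (auto simp: sphere_to_cross_def)
    qed
    have "(\<Sum>v | ?x v \<noteq> 0. ?x v) = sum ?x ({..n} \<times> UNIV)"
      using sub by (intro sum_support_eq) auto
    also have "\<dots> = (\<Sum>i\<le>n. (u i)\<^sup>2)"
      unfolding sum_times_bool
      by (intro sum.cong refl) (auto simp: sphere_to_cross_def max_def)
    finally have sum: "(\<Sum>v | ?x v \<noteq> 0. ?x v) = 1"
      using u by simp
    then have "{v. ?x v \<noteq> 0} \<noteq> {}"
      by (metis sum.empty zero_neq_one)
    then have "{v. ?x v \<noteq> 0} \<in> cross_polytope n"
      using sub by (auto simp: cross_polytope_def sphere_to_cross_def max_def split: if_splits)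
    then show "?x \<in> topspace (geometric_realization (cross_polytope n))"
      using sum by (auto simp: topspace_geometric_realization sphere_to_cross_def)
  qed
qed

lemma continuous_map_cross_to_sphere:
  "continuous_map (geometric_realization (cross_polytope n)) (nsphere n) cross_to_sphere"
proof -
  have "continuous_map (geometric_realization (cross_polytope n)) euclideanreal
      (\<lambda>x. cross_to_sphere x i)" for i
    unfolding cross_to_sphere_def
    by (intro continuous_intros continuous_map_barycentric_coordinate)
  moreover have "(\<Sum>i\<le>n. (cross_to_sphere x i)\<^sup>2) = 1 \<and> (\<forall>i>n. cross_to_sphere x i = 0)"
    if x: "x \<in> topspace (geometric_realization (cross_polytope n))" for x
  proof -
    have pos: "\<And>v. 0 \<le> x v" and supp: "{v. x v \<noteq> 0} \<in> cross_polytope n"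
      and sum: "(\<Sum>v | x v \<noteq> 0. x v) = 1"
      using x by (auto simp: topspace_geometric_realization)
    have opp: "x (i, True) = 0 \<or> x (i, False) = 0" for i
      using supp by (auto simp: cross_polytope_def)
    have sub: "{v. x v \<noteq> 0} \<subseteq> {..n} \<times> UNIV"
      using supp by (simp add: cross_polytope_def)
    have "(cross_to_sphere x i)\<^sup>2 = x (i, True) + x (i, False)" for i
      using opp[of i] pos by (auto simp: cross_to_sphere_def)
    then have "(\<Sum>i\<le>n. (cross_to_sphere x i)\<^sup>2) = 1"
      using sum sum_support_eq[OF _ sub] by (simp add: sum_times_bool)
    moreover have "x (i, s) = 0" if "i > n" for i s
      using sub that by auto
    ultimately show ?thesis
      by (simp add: cross_to_sphere_def)
  qed
  ultimately show ?thesis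
    by (auto simp: nsphere continuous_map_in_subtopology continuous_map_componentwise_UNIV)
qed

text \<open>If the boundary of a cross-polytope is a simplicial retract of \<open>K\<close>, the identity of the sphere
  factors through the realization of \<open>K\<close>. Were that contractible, the sphere would be so too.\<close>

lemma not_contractible_of_cross_polytope_retract:
  assumes V: "finite V" "\<Union>K \<subseteq> V"
    and r: "\<And>\<sigma>. \<sigma> \<in> K \<Longrightarrow> r ` \<sigma> \<in> cross_polytope n"
    and s: "\<And>\<sigma>. \<sigma> \<in> cross_polytope n \<Longrightarrow> s ` \<sigma> \<in> K"
    and rs: "\<And>p. p \<in> {..n} \<times> UNIV \<Longrightarrow> r (s p) = p"
  shows "\<not> contractible_space (geometric_realization K)"
proof
  assume contr: "contractible_space (geometric_realization K)"
  let ?W = "{..n} \<times> (UNIV :: bool set)"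
  have W: "finite ?W" "\<Union>(cross_polytope n) \<subseteq> ?W"
    by (auto simp: cross_polytope_def)
  have sV: "s ` ?W \<subseteq> V"
  proof
    fix v
    assume "v \<in> s ` ?W"
    then obtain p where p: "p \<in> ?W" "v = s p"
      by blast
    then have "s ` {p} \<in> K"
      by (intro s) (auto simp: cross_polytope_def)
    then show "v \<in> V"
      using p V by auto
  qed
  let ?into = "pushforward ?W s \<circ> sphere_to_cross"
  let ?onto = "cross_to_sphere \<circ> pushforward V r"
  have "continuous_map (nsphere n) (geometric_realization K) ?into"
    using continuous_map_sphere_to_cross continuous_map_pushforward[OF W s]
    by (rule continuous_map_compose)
  moreover have "continuous_map (geometric_realization K) (nsphere n) ?onto"
    using continuous_map_pushforward[OF V r] continuous_map_cross_to_sphere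
    by (rule continuous_map_compose)
  ultimately obtain c
    where c: "homotopic_with (\<lambda>_. True) (nsphere n) (nsphere n) (?onto \<circ> ?into) (\<lambda>_. c)"
    using contr by (rule nullhomotopic_through_contractible_space)
  have "(?onto \<circ> ?into) u = u" if "u \<in> topspace (nsphere n)" for u
  proof -
    have "sphere_to_cross u \<in> topspace (geometric_realization (cross_polytope n))"
      using continuous_map_sphere_to_cross[of n] that by (auto simp: continuous_map_def)
    then have "{p. sphere_to_cross u p \<noteq> 0} \<subseteq> ?W"
      using W by (auto simp: topspace_geometric_realization)
    then have "pushforward V r (pushforward ?W s (sphere_to_cross u)) = sphere_to_cross u"
      by (simp only: pushforward_pushforward[OF W(1) V(1) sV] pushforward_cong[OF rs] pushforward_id)
    then show ?thesis
      by (simp add: cross_to_sphere_to_cross)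
  qed
  then have "homotopic_with (\<lambda>_. True) (nsphere n) (nsphere n) id (\<lambda>_. c)"
    using c by (elim homotopic_with_eq) auto
  then show False
    using non_contractible_space_nsphere by (auto simp: contractible_space_def)
qed

section \<open>Order complexes\<close>

text \<open>Chains and faces of cross-polytopes are defined by conditions on pairs, so whether the maps
  \<open>r\<close> and \<open>s\<close> are simplicial can be decided on pairs of elements.\<close>

lemma order_complex_not_contractible:
  fixes r :: "'a \<Rightarrow> nat \<times> bool" and n :: nat
  assumes S: "finite S"
    and r: "r ` S \<subseteq> {..n} \<times> UNIV"
    and r_le: "\<And>x y. \<lbrakk>x \<in> S; y \<in> S; R x y; fst (r x) = fst (r y)\<rbrakk> \<Longrightarrow> r x = r y"
    and s: "s ` ({..n} \<times> UNIV) \<subseteq> S"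
    and s_refl: "\<And>p. p \<in> {..n} \<times> UNIV \<Longrightarrow> R (s p) (s p)"
    and s_le: "\<And>i j t u. \<lbrakk>i < j; j \<le> n\<rbrakk> \<Longrightarrow> R (s (i, t)) (s (j, u))"
    and rs: "\<And>p. p \<in> {..n} \<times> UNIV \<Longrightarrow> r (s p) = p"
  shows "\<not> contractible_space (geometric_realization (order_complex R S))"
proof (rule not_contractible_of_cross_polytope_retract[where V = S and n = n and r = r and s = s])
  show "finite S"
    by (rule S)
  show "r (s p) = p" if "p \<in> {..n} \<times> UNIV" for p
    using that by (rule rs)
  show "\<Union>(order_complex R S) \<subseteq> S"
    by (auto simp: order_complex_def)
  show "r ` \<sigma> \<in> cross_polytope n" if "\<sigma> \<in> order_complex R S" for \<sigma>
  proof -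
    have \<sigma>: "\<sigma> \<subseteq> S" "\<sigma> \<noteq> {}" "Complete_Partial_Order.chain R \<sigma>"
      using that by (auto simp: order_complex_def)
    have "\<not> ((i, True) \<in> r ` \<sigma> \<and> (i, False) \<in> r ` \<sigma>)" for i
    proof
      assume "(i, True) \<in> r ` \<sigma> \<and> (i, False) \<in> r ` \<sigma>"
      then obtain x y where "x \<in> \<sigma>" "y \<in> \<sigma>" "r x = (i, True)" "r y = (i, False)"
        by (metis imageE)
      with r_le[of x y] r_le[of y x] \<sigma> show False
        by (auto simp: chain_def)
    qed
    moreover have "r ` \<sigma> \<subseteq> {..n} \<times> UNIV"
      using \<sigma>(1) r by blast
    ultimately show ?thesis
      using \<sigma>(2) by (simp add: cross_polytope_def)
  qed
  show "s ` \<sigma> \<in> order_complex R S" if "\<sigma> \<in> cross_polytope n" for \<sigma>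
  proof -
    have \<sigma>: "\<sigma> \<noteq> {}" "\<sigma> \<subseteq> {..n} \<times> UNIV"
      and opp: "\<And>i. \<not> ((i, True) \<in> \<sigma> \<and> (i, False) \<in> \<sigma>)"
      using that by (auto simp: cross_polytope_def)
    have "R (s p) (s q) \<or> R (s q) (s p)" if "p \<in> \<sigma>" "q \<in> \<sigma>" for p q
    proof -
      obtain i t j u where pq: "p = (i, t)" "q = (j, u)"
        by fastforce
      have "i \<le> n" "j \<le> n"
        using \<sigma> that pq by auto
      moreover have "t = u" if "i = j"
        using opp[of i] \<open>p \<in> \<sigma>\<close> \<open>q \<in> \<sigma>\<close> pq that by (cases t; cases u) auto
      ultimately show ?thesis
        using s_le[of i j t u] s_le[of j i u t] s_refl[of p] pq
        by (cases i j rule: linorder_cases) auto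
    qed
    then have "Complete_Partial_Order.chain R (s ` \<sigma>)"
      by (auto simp: chain_def)
    moreover have "finite \<sigma>"
      using finite_subset[OF \<sigma>(2)] by simp
    moreover have "s ` \<sigma> \<subseteq> S"
      using \<sigma>(2) s by blast
    ultimately show ?thesis
      using \<sigma>(1) by (simp add: order_complex_def)
  qed
qed

lemma order_complex_contiguous:
  assumes S: "finite S" and f: "f ` S \<subseteq> S" and g: "g ` S \<subseteq> S"
    and comp: "\<And>x y u v. \<lbrakk>x \<in> S; y \<in> S; R x y; u \<in> {f x, g x}; v \<in> {f y, g y}\<rbrakk> \<Longrightarrow>
      R u v \<or> R v u"
  shows "homotopic_with (\<lambda>_. True) (geometric_realization (order_complex R S))
           (geometric_realization (order_complex R S)) (pushforward S f) (pushforward S g)"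
proof (rule homotopic_contiguous[OF S])
  show "\<Union>(order_complex R S) \<subseteq> S"
    by (auto simp: order_complex_def)
  \<comment> \<open>The sets in all three conditions of contiguity lie in \<open>f ` \<sigma> \<union> g ` \<sigma>\<close>.\<close>
  have sub: "C \<in> order_complex R S"
    if \<sigma>: "\<sigma> \<in> order_complex R S" and C: "C \<subseteq> f ` \<sigma> \<union> g ` \<sigma>" "C \<noteq> {}" for C \<sigma>
  proof -
    have "R u v \<or> R v u" if "u \<in> C" "v \<in> C" for u v
    proof -
      have "u \<in> f ` \<sigma> \<union> g ` \<sigma>" "v \<in> f ` \<sigma> \<union> g ` \<sigma>"
        using that C by auto
      then obtain x y where xy: "x \<in> \<sigma>" "y \<in> \<sigma>" and uv: "u \<in> {f x, g x}" "v \<in> {f y, g y}"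
        by (elim UnE imageE) simp_all
      from xy have "x \<in> S" "y \<in> S" "R x y \<or> R y x"
        using \<sigma> by (auto simp: order_complex_def chain_def)
      then show ?thesis
        using comp[of x y u v] comp[of y x v u] uv by argo
    qed
    moreover have "\<sigma> \<subseteq> S" "finite \<sigma>"
      using \<sigma> by (auto simp: order_complex_def)
    then have "f ` \<sigma> \<union> g ` \<sigma> \<subseteq> S" "finite (f ` \<sigma> \<union> g ` \<sigma>)"
      using f g by blast+
    with C(1) have "C \<subseteq> S" "finite C"
      by (auto intro: finite_subset)
    ultimately show ?thesis
      using C by (auto simp: order_complex_def chain_def)
  qed
  fix \<sigma>
  assume "\<sigma> \<in> order_complex R S"
  moreover from this have "\<sigma> \<noteq> {}"
    by (simp add: order_complex_def)
  ultimately show "f ` \<sigma> \<in> order_complex R S" "g ` \<sigma> \<in> order_complex R S"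
    "f ` \<sigma> \<union> g ` \<sigma> \<in> order_complex R S"
    by (auto intro: sub)
qed

section \<open>The proper part of the divisibility order\<close>

lemma proper_part_eq:
  assumes "0 < a" "0 < b"
  shows "P a b - {(0, 0), (a, b)} = {..<a} \<times> {..<b} - {(0, 0)}"
  using assms by (auto simp: P_def pd_le_def properly_divides_def)

lemma not_contractible_Delta_P_2:
  assumes "2 \<le> b"
  shows "\<not> contractible_space (geometric_realization (Delta_P 2 b))"
  unfolding Delta_P_def
  using assms
  by (intro order_complex_not_contractible[where n = 0 and r = "\<lambda>x. (0, x = (1, 0))"
      and s = "\<lambda>(i, t). if t then (1, 0) else (0, 1)"])
    (auto simp: proper_part_eq pd_le_def properly_divides_def split: if_splits)

text \<open>The vertices \<open>(0, True)\<close>, \<open>(0, False)\<close>, \<open>(1, True)\<close>, \<open>(1, False)\<close> of the square are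
  the images of \<open>(1, 1)\<close>, of the neighbours of \<open>(2, b - 1)\<close> other than \<open>(1, 1)\<close>, of \<open>(2, b - 1)\<close>
  itself and of everything else. Nothing lies above \<open>(2, b - 1)\<close>, so its neighbours are the
  elements below it; none of them but \<open>(1, 1)\<close> is comparable to \<open>(1, 1)\<close>. Hence no edge of the
  complex joins elements mapped to opposite corners.\<close>

lemma not_contractible_Delta_P_ge:
  assumes "3 \<le> a" "4 \<le> b"
  shows "\<not> contractible_space (geometric_realization (Delta_P a b))"
proof -
  let ?r = "\<lambda>x. if x = (1, 1) then (0, True) else if x = (2, b - 1) then (1, True)
              else if properly_divides x (2, b - 1) then (0, False) else (1 :: nat, False)"
  let ?s = "\<lambda>(i :: nat, t). if i = 0 then (if t then (1, 1) else (1, 0))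
              else (if t then (2, b - 1) else (2, b - 2))"
  show ?thesis
    unfolding Delta_P_def
  proof (rule order_complex_not_contractible[where n = 1 and r = ?r and s = ?s])
    show "finite (P a b - {(0, 0), (a, b)})"
      using assms by (simp add: proper_part_eq)
    show "?r ` (P a b - {(0, 0), (a, b)}) \<subseteq> {..1} \<times> UNIV"
      by auto
    show "?r x = ?r y"
      if "x \<in> P a b - {(0, 0), (a, b)}" "y \<in> P a b - {(0, 0), (a, b)}" "pd_le x y"
        "fst (?r x) = fst (?r y)" for x y
      using that assms
      by (auto simp: proper_part_eq pd_le_def properly_divides_def split: if_splits)
    show "?s ` ({..1} \<times> UNIV) \<subseteq> P a b - {(0, 0), (a, b)}"
      using assms by (auto simp: proper_part_eq split: if_splits)
    show "pd_le (?s p) (?s p)" for p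
      by (simp add: pd_le_def)
    show "pd_le (?s (i, t)) (?s (j, u))" if "i < j" "j \<le> 1" for i j t u
      using that assms by (auto simp: pd_le_def properly_divides_def)
    show "?r (?s p) = p" if "p \<in> {..1} \<times> UNIV" for p
      using that assms by (cases "snd p") (auto simp: properly_divides_def le_Suc_eq)
  qed
qed

section \<open>The tree for (3, 3)\<close>

lemma proper_part_3_3:
  "P 3 3 - {(0, 0), (3, 3)} = {(0,1), (0,2), (1,0), (1,1), (1,2), (2,0), (2,1), (2,2)}"
proof -
  have three: "{..<3::nat} = {0, 1, 2}"
    by auto
  have "P 3 3 - {(0, 0), (3, 3)} = {..<3} \<times> {..<3} - {(0, 0)}"
    by (rule proper_part_eq) simp_all
  then show ?thesis
    unfolding three by auto
qed

definition tree_edges :: "((nat \<times> nat) \<times> (nat \<times> nat)) set" where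
  "tree_edges = {((1,0), (2,0)), ((1,0), (2,1)), ((1,0), (2,2)), ((0,1), (0,2)), ((0,1), (1,2)),
     ((0,1), (2,2)), ((1,1), (2,2))}"

lemma pd_le_3_3_iff:
  assumes "x \<in> P 3 3 - {(0, 0), (3, 3)}" "y \<in> P 3 3 - {(0, 0), (3, 3)}"
  shows "pd_le x y \<longleftrightarrow> x = y \<or> (x, y) \<in> tree_edges"
proof -
  have "\<forall>x\<in>P 3 3 - {(0, 0), (3, 3)}. \<forall>y\<in>P 3 3 - {(0, 0), (3, 3)}.
      properly_divides x y \<longleftrightarrow> (x, y) \<in> tree_edges"
    unfolding proper_part_3_3 tree_edges_def by (simp add: properly_divides_def)
  then show ?thesis
    using assms by (simp add: pd_le_def)
qed

text \<open>The first homotopy moves the leaves of the tree: those attached to \<open>(1, 0)\<close> and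
  \<open>(0, 1)\<close> onto these vertices, and \<open>(1, 1)\<close> onto \<open>(2, 2)\<close>. What is left is the path from \<open>(1, 0)\<close> over
  \<open>(2, 2)\<close> to \<open>(0, 1)\<close>, on which the constant map \<open>(2, 2)\<close> is contiguous to the identity.\<close>

lemma contractible_Delta_P_3_3: "contractible_space (geometric_realization (Delta_P 3 3))"
proof -
  let ?S = "P 3 3 - {(0, 0), (3, 3)}" and ?K = "Delta_P 3 3"
  let ?X = "geometric_realization ?K"
  define fold :: "nat \<times> nat \<Rightarrow> nat \<times> nat" where
    "fold x = (if x \<in> {(2,0), (2,1), (1,0)} then (1,0)
               else if x \<in> {(0,2), (1,2), (0,1)} then (0,1) else (2,2))" for x
  have fin: "finite ?S"
    by (simp add: proper_part_3_3)
  have fold_S: "fold x \<in> ?S" for x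
    by (simp add: proper_part_3_3 fold_def)
  then have fold_image: "fold ` ?S \<subseteq> ?S"
    by (rule image_subsetI)
  have comp: "pd_le u v \<or> pd_le v u"
    if "u \<in> ?S" "v \<in> ?S" "u = v \<or> (u, v) \<in> tree_edges \<or> (v, u) \<in> tree_edges" for u v
    using that pd_le_3_3_iff by blast
  \<comment> \<open>The vertex and edge facts are the contiguity conditions on comparable pairs, for equal and for
    distinct elements.\<close>
  have vertex: "(x = fold x \<or> (x, fold x) \<in> tree_edges \<or> (fold x, x) \<in> tree_edges) \<and>
      (fold x = (2, 2) \<or> (fold x, (2, 2)) \<in> tree_edges)" if "x \<in> ?S" for x
  proof -
    have "\<forall>x\<in>?S. (x = fold x \<or> (x, fold x) \<in> tree_edges \<or> (fold x, x) \<in> tree_edges) \<and>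
      (fold x = (2, 2) \<or> (fold x, (2, 2)) \<in> tree_edges)"
      unfolding proper_part_3_3 tree_edges_def by (simp add: fold_def)
    then show ?thesis
      using that by (rule bspec)
  qed
  have edge: "(fold x = fold y \<or> (fold x, fold y) \<in> tree_edges \<or> (fold y, fold x) \<in> tree_edges) \<and>
      (fold x = y \<or> (fold x, y) \<in> tree_edges) \<and>
      (x = fold y \<or> (x, fold y) \<in> tree_edges \<or> (fold y, x) \<in> tree_edges)"
    if "(x, y) \<in> tree_edges" for x y
    using that unfolding tree_edges_def by (elim insertE) (simp_all add: fold_def)
  have "homotopic_with (\<lambda>_. True) ?X ?X (pushforward ?S (\<lambda>x. x)) (pushforward ?S fold)"
    unfolding Delta_P_def
  proof (rule order_complex_contiguous[OF fin])
    fix x y u v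
    assume xy: "x \<in> ?S" "y \<in> ?S" "pd_le x y" and uv: "u \<in> {x, fold x}" "v \<in> {y, fold y}"
    have "u \<in> ?S" "v \<in> ?S"
      using xy uv fold_S by (metis insertE singletonD)+
    moreover have "u = v \<or> (u, v) \<in> tree_edges \<or> (v, u) \<in> tree_edges"
      using pd_le_3_3_iff[OF xy(1,2)] xy(3) vertex[OF xy(1)] edge[of x y] uv
      by (metis insertE singletonD)
    ultimately show "pd_le u v \<or> pd_le v u"
      by (rule comp)
  qed (simp_all only: fold_image image_ident order_refl)
  moreover have "homotopic_with (\<lambda>_. True) ?X ?X (pushforward ?S fold) (pushforward ?S (\<lambda>_. (2, 2)))"
    unfolding Delta_P_def
  proof (rule order_complex_contiguous[OF fin])
    have centre: "(2, 2) \<in> ?S"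
      by (simp add: proper_part_3_3)
    then show "(\<lambda>_. (2, 2)) ` ?S \<subseteq> ?S"
      by (rule image_subsetI)
    fix x y u v
    assume xy: "x \<in> ?S" "y \<in> ?S" "pd_le x y"
      and uv: "u \<in> {fold x, (2, 2)}" "v \<in> {fold y, (2, 2)}"
    have "u \<in> ?S" "v \<in> ?S"
      using centre uv fold_S by (metis insertE singletonD)+
    moreover have "u = v \<or> (u, v) \<in> tree_edges \<or> (v, u) \<in> tree_edges"
      using pd_le_3_3_iff[OF xy(1,2)] xy(3) vertex[OF xy(1)] vertex[OF xy(2)] edge[of x y] uv
      by (metis insertE singletonD)
    ultimately show "pd_le u v \<or> pd_le v u"
      by (rule comp)
  qed (simp_all only: fold_image image_ident order_refl)
  ultimately have hom: "homotopic_with (\<lambda>_. True) ?X ?X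
      (pushforward ?S (\<lambda>x. x)) (pushforward ?S (\<lambda>_. (2,2)))"
    by (rule homotopic_with_trans)
  let ?c = "\<lambda>v :: nat \<times> nat. if v = (2, 2) then 1 else 0 :: real"
  have "pushforward ?S (\<lambda>x. x) x = x \<and> pushforward ?S (\<lambda>_. (2, 2)) x = ?c"
    if x: "x \<in> topspace ?X" for x
  proof -
    have sub: "{u. x u \<noteq> 0} \<subseteq> ?S" and sum: "(\<Sum>u | x u \<noteq> 0. x u) = 1"
      using x by (auto simp: topspace_geometric_realization Delta_P_def order_complex_def)
    have "pushforward ?S (\<lambda>_. (2, 2)) x = ?c"
      using sum sum_support_eq[OF fin sub] by (simp add: pushforward_const fun_eq_iff)
    then show ?thesis
      using sub by (simp add: pushforward_id)
  qed
  then have "homotopic_with (\<lambda>_. True) ?X ?X id (\<lambda>_. ?c)"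
    by (intro homotopic_with_eq[OF hom]) simp_all
  then show ?thesis
    by (auto simp: contractible_space_def)
qed

lemma elementary_collapse_leaf:
  assumes "v \<notin> \<Union>L" "v \<noteq> w"
  shows "elementary_collapse (insert {v} (insert {v, w} L)) L"
proof -
  have "{\<rho> \<in> insert {v} (insert {v, w} L). {v} \<subset> \<rho>} = {{v, w}}"
    using assms by auto
  moreover have "L = insert {v} (insert {v, w} L) - {{v, w}, {v}}"
    using assms by auto
  ultimately show ?thesis
    unfolding elementary_collapse_def by blast
qed

text \<open>Chains have at most two elements: \<open>(1, 0)\<close>, \<open>(0, 1)\<close> and \<open>(1, 1)\<close> are minimal and the other
  five elements are maximal. The edges are listed in an order in which leaves can be removed: the first
  vertex of each edge occurs in no later simplex.\<close>

lemma Delta_P_3_3_eq: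
  "Delta_P 3 3 =
     {{(2,0)}, {(2,0), (1,0)}, {(2,1)}, {(2,1), (1,0)}, {(0,2)}, {(0,2), (0,1)},
      {(1,2)}, {(1,2), (0,1)}, {(1,1)}, {(1,1), (2,2)}, {(1,0)}, {(1,0), (2,2)},
      {(0,1)}, {(0,1), (2,2)}, {(2,2)}}" (is "_ = ?T")
proof
  let ?S = "P 3 3 - {(0, 0), (3, 3)}" and ?low = "{(1,0), (0,1), (1,1)} :: (nat \<times> nat) set"
  have low_edge: "x \<in> ?low \<and> y \<notin> ?low" if "(x, y) \<in> tree_edges" for x y
    using that unfolding tree_edges_def by (elim insertE) simp_all
  have face: "{x, y} \<in> ?T" if "(x, y) \<in> tree_edges" for x y
    using that unfolding tree_edges_def
    by (elim insertE) (simp_all add: doubleton_eq_iff)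
  show "Delta_P 3 3 \<subseteq> ?T"
  proof
    fix C
    assume "C \<in> Delta_P 3 3"
    then have C: "C \<subseteq> ?S" "C \<noteq> {}"
      and chain: "\<And>x y. \<lbrakk>x \<in> C; y \<in> C\<rbrakk> \<Longrightarrow> pd_le x y \<or> pd_le y x"
      by (auto simp: Delta_P_def order_complex_def chain_def)
    have edge: "(x, y) \<in> tree_edges \<or> (y, x) \<in> tree_edges"
      if "x \<in> C" "y \<in> C" "x \<noteq> y" for x y
      using chain[OF that(1,2)] that pd_le_3_3_iff[of x y] pd_le_3_3_iff[of y x] subsetD[OF C(1)]
      by metis
    have low: "x \<in> ?low \<longleftrightarrow> y \<notin> ?low" if "x \<in> C" "y \<in> C" "x \<noteq> y" for x y
      using edge[OF that] low_edge[of x y] low_edge[of y x] by argo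
    obtain x where x: "x \<in> C"
      using C by blast
    show "C \<in> ?T"
    proof (cases "C = {x}")
      case True
      then show ?thesis
        using x C unfolding proper_part_3_3 by auto
    next
      case False
      then obtain y where y: "y \<in> C" "x \<noteq> y"
        using x by blast
      have "z \<in> {x, y}" if "z \<in> C" for z
        using low[OF x that] low[OF y(1) that] low[OF x y] by (metis insertCI)
      then have "C = {x, y}"
        using x y by blast
      then show ?thesis
        using edge[OF x y] face[of x y] face[of y x] by (metis insert_commute)
    qed
  qed
  show "?T \<subseteq> Delta_P 3 3"
    unfolding Delta_P_def order_complex_def proper_part_3_3
    by (simp add: chain_def pd_le_def properly_divides_def)
qed

lemma collapsible_Delta_P_3_3: "collapsible (Delta_P 3 3)"
proof -
  have leaf: "elementary_collapse\<^sup>*\<^sup>* (insert {v} (insert {v, w} L)) M"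
    if "v \<notin> \<Union>L" "v \<noteq> w" "elementary_collapse\<^sup>*\<^sup>* L M" for v w :: "nat \<times> nat" and L M
    using elementary_collapse_leaf[OF that(1,2)] that(3) by (rule converse_rtranclp_into_rtranclp)
  have "elementary_collapse\<^sup>*\<^sup>* (Delta_P 3 3) {{(2, 2)}}"
    unfolding Delta_P_3_3_eq by (intro leaf rtranclp.rtrancl_refl) simp_all
  then show ?thesis
    unfolding collapsible_def by blast
qed

theorem corollary3p6:
  shows "(\<forall>a b :: nat. 2 \<le> a \<and> a \<le> b \<longrightarrow>
            (contractible_space (geometric_realization (Delta_P a b)) \<longleftrightarrow> a = 3 \<and> b = 3)) \<and>
         collapsible (Delta_P 3 3)"
proof (intro conjI allI impI)
  fix a b :: nat
  assume ab: "2 \<le> a \<and> a \<le> b"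
  then consider "a = 2" | "a = 3" "b = 3" | "3 \<le> a" "4 \<le> b"
    by linarith
  then show "contractible_space (geometric_realization (Delta_P a b)) \<longleftrightarrow> a = 3 \<and> b = 3"
    using ab not_contractible_Delta_P_2 not_contractible_Delta_P_ge contractible_Delta_P_3_3
    by cases auto
qed (rule collapsible_Delta_P_3_3)

end
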